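(* Let $n \geq 2$ be an integer and let $Q_{4n} = \langle x, y : y^{2n} = 1, x^2 = y^n, xyx^{-1} = y^{-1}\rangle$ be the generalized quaternion group of order $4n$. Then the Laplacian spectrum of the non-commuting graph $\mathcal{A}_{Q_{4n}}$ of $Q_{4n}$ is $$\{0, (2n)^{2n-3}, (4n-4)^n, (4n-2)^n\}.$$
   Context: For a finite non-abelian group $G$ with centre $Z(G)$, the non-commuting graph $\mathcal{A}_G$ is the simple undirected graph with vertex set $G \setminus Z(G)$ in which two vertices $x,y$ are adjacent if and only if $xy \neq yx$. The Laplacian matrix of a finite graph is $D - A$, with $D$ the degree matrix and $A$ the adjacency matrix. The Laplacian spectrum is the multiset of eigenvalues of the Laplacian matrix; $\{\dots,\alpha^{a},\dots\}$ means the eigenvalue $\alpha$ is listed with multiplicity $a$ (not a power; no exponent means once, exponent $0$ means the entry is absent, and if listed values coincide their multiplicities add). *)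

theory Defs
  imports
    "HOL-Algebra.Group"
    "Graph_Theory.Pair_Digraph"
    "Jordan_Normal_Form.Char_Poly"
begin

section \<open>Groups given by generators and relations\<close>

datatype 'a letter = Gen 'a | GenInv 'a

text \<open>A relation \<open>u = v\<close> is the pair of words \<open>(u, v)\<close>. The relation below is the smallest
  congruence on words that contains the given relations and the cancellation laws; the presented
  group is the free monoid of words modulo this congruence.\<close>

inductive pres_eq :: "('a letter list \<times> 'a letter list) set \<Rightarrow> 'a letter list \<Rightarrow> 'a letter list \<Rightarrow> bool"
  for R where
  rel: "(u, v) \<in> R \<Longrightarrow> pres_eq R u v"
| cancel1: "pres_eq R [Gen a, GenInv a] []"
| cancel2: "pres_eq R [GenInv a, Gen a] []"
| refl: "pres_eq R u u"
| sym: "pres_eq R u v \<Longrightarrow> pres_eq R v u"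
| trans: "pres_eq R u v \<Longrightarrow> pres_eq R v w \<Longrightarrow> pres_eq R u w"
| cong: "pres_eq R u u' \<Longrightarrow> pres_eq R v v' \<Longrightarrow> pres_eq R (u @ v) (u' @ v')"

definition pres_rel :: "('a letter list \<times> 'a letter list) set \<Rightarrow> 'a letter list rel" where
  "pres_rel R = {(u, v). pres_eq R u v}"

definition presented_group :: "('a letter list \<times> 'a letter list) set \<Rightarrow> 'a letter list set monoid" where
  "presented_group R =
    \<lparr> carrier = UNIV // pres_rel R,
      mult = (\<lambda>A B. \<Union>u\<in>A. \<Union>v\<in>B. pres_rel R `` {u @ v}),
      one = pres_rel R `` {[]} \<rparr>"

lemma equiv_pres_rel: "equiv UNIV (pres_rel R)"
  by (auto intro!: equivI refl_onI symI transI simp: pres_rel_def intro: pres_eq.intros)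

lemma presented_group_mult_class:
  "(pres_rel R `` {u}) \<otimes>\<^bsub>presented_group R\<^esub> (pres_rel R `` {v}) = pres_rel R `` {u @ v}"
proof -
  have "pres_rel R `` {u' @ v'} = pres_rel R `` {u @ v}"
    if "(u, u') \<in> pres_rel R" "(v, v') \<in> pres_rel R" for u' v'
    using that by (intro equiv_class_eq[OF equiv_pres_rel])
      (auto simp: pres_rel_def intro: pres_eq.cong pres_eq.sym)
  then have "(\<Union>u'\<in>pres_rel R `` {u}. \<Union>v'\<in>pres_rel R `` {v}. pres_rel R `` {u' @ v'})
      = (\<Union>u'\<in>pres_rel R `` {u}. \<Union>v'\<in>pres_rel R `` {v}. pres_rel R `` {u @ v})"
    by (intro SUP_cong) auto
  moreover have "u \<in> pres_rel R `` {u}" "v \<in> pres_rel R `` {v}"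
    by (auto simp: pres_rel_def intro: pres_eq.refl)
  then have "(\<Union>u'\<in>pres_rel R `` {u}. \<Union>v'\<in>pres_rel R `` {v}. pres_rel R `` {u @ v})
      = pres_rel R `` {u @ v}"
    by (metis SUP_const empty_iff)
  ultimately show ?thesis
    by (simp add: presented_group_def)
qed

fun letter_inv :: "'a letter \<Rightarrow> 'a letter" where
  "letter_inv (Gen a) = GenInv a"
| "letter_inv (GenInv a) = Gen a"

lemma pres_eq_inv_word: "pres_eq R (rev (map letter_inv w) @ w) []"
proof (induction w)
  case Nil
  show ?case by (simp add: pres_eq.refl)
next
  case (Cons l w)
  have "pres_eq R [letter_inv l, l] []"
    by (cases l) (auto intro: pres_eq.intros)
  from pres_eq.cong[OF this pres_eq.refl[of R w]]
  have "pres_eq R ([letter_inv l, l] @ w) w" by simp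
  from pres_eq.cong[OF pres_eq.refl[of R "rev (map letter_inv w)"] this]
  show ?case using Cons.IH by (auto intro: pres_eq.trans)
qed

lemma group_presented_group: "group (presented_group R)"
proof (rule groupI)
  let ?G = "presented_group R"
  have car: "x \<in> carrier ?G \<longleftrightarrow> (\<exists>w. x = pres_rel R `` {w})" for x
    by (auto simp: presented_group_def quotient_def)
  have one: "\<one>\<^bsub>?G\<^esub> = pres_rel R `` {[]}"
    by (simp add: presented_group_def)
  note m = presented_group_mult_class
  show "\<one>\<^bsub>?G\<^esub> \<in> carrier ?G" using car one by blast
  show "x \<otimes>\<^bsub>?G\<^esub> y \<in> carrier ?G" if "x \<in> carrier ?G" "y \<in> carrier ?G" for x y
    using that m unfolding car by blast
  show "x \<otimes>\<^bsub>?G\<^esub> y \<otimes>\<^bsub>?G\<^esub> z = x \<otimes>\<^bsub>?G\<^esub> (y \<otimes>\<^bsub>?G\<^esub> z)"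
    if "x \<in> carrier ?G" "y \<in> carrier ?G" "z \<in> carrier ?G" for x y z
    using that unfolding car by (auto simp: m)
  show "\<one>\<^bsub>?G\<^esub> \<otimes>\<^bsub>?G\<^esub> x = x" if "x \<in> carrier ?G" for x
    using that unfolding car one by (auto simp: m)
  show "\<exists>y\<in>carrier ?G. y \<otimes>\<^bsub>?G\<^esub> x = \<one>\<^bsub>?G\<^esub>" if x: "x \<in> carrier ?G" for x
  proof -
    obtain w where w: "x = pres_rel R `` {w}" using x car by blast
    let ?y = "pres_rel R `` {rev (map letter_inv w)}"
    have "?y \<otimes>\<^bsub>?G\<^esub> x = \<one>\<^bsub>?G\<^esub>"
      unfolding w m one
      by (rule equiv_class_eq[OF equiv_pres_rel]) (simp add: pres_rel_def pres_eq_inv_word)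
    moreover have "?y \<in> carrier ?G" using car by blast
    ultimately show ?thesis by blast
  qed
qed

text \<open>The universal property: generators of a group \<open>H\<close> satisfying the relations determine
  a homomorphism from the presented group, by evaluation of words.\<close>

fun letter_eval :: "('h, 'm) monoid_scheme \<Rightarrow> ('a \<Rightarrow> 'h) \<Rightarrow> 'a letter \<Rightarrow> 'h" where
  "letter_eval H f (Gen a) = f a"
| "letter_eval H f (GenInv a) = inv\<^bsub>H\<^esub> f a"

definition word_eval :: "('h, 'm) monoid_scheme \<Rightarrow> ('a \<Rightarrow> 'h) \<Rightarrow> 'a letter list \<Rightarrow> 'h" where
  "word_eval H f w = foldr (\<lambda>l h. letter_eval H f l \<otimes>\<^bsub>H\<^esub> h) w \<one>\<^bsub>H\<^esub>"

lemma word_eval_closed: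
  assumes "group H" "range f \<subseteq> carrier H"
  shows "word_eval H f w \<in> carrier H"
proof -
  interpret group H by fact
  have "letter_eval H f l \<in> carrier H" for l
    using assms(2) by (cases l) auto
  then show ?thesis by (induction w) (auto simp: word_eval_def)
qed

lemma word_eval_append:
  assumes "group H" "range f \<subseteq> carrier H"
  shows "word_eval H f (u @ v) = word_eval H f u \<otimes>\<^bsub>H\<^esub> word_eval H f v"
proof -
  interpret group H by fact
  have l: "letter_eval H f l \<in> carrier H" for l
    using assms(2) by (cases l) auto
  note c = word_eval_closed[OF assms]
  show ?thesis
  proof (induction u)
    case Nil
    show ?case using c[of v] by (simp add: word_eval_def)
  next
    case (Cons a u)
    then show ?case using l[of a] c[of u] c[of v]
      by (simp add: word_eval_def m_assoc)
  qed
qed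

lemma word_eval_pres_eq:
  assumes "group H" "range f \<subseteq> carrier H"
    and "\<And>u v. (u, v) \<in> R \<Longrightarrow> word_eval H f u = word_eval H f v"
    and "pres_eq R u v"
  shows "word_eval H f u = word_eval H f v"
proof -
  interpret group H by fact
  have f: "f a \<in> carrier H" for a using assms(2) by auto
  from assms(4) show ?thesis
  proof (induction rule: pres_eq.induct)
    case (rel u v)
    then show ?case by (rule assms(3))
  next
    case (cancel1 a)
    show ?case using f[of a] by (simp add: word_eval_def)
  next
    case (cancel2 a)
    show ?case using f[of a] by (simp add: word_eval_def)
  next
    case (cong u u' v v')
    then show ?case by (simp add: word_eval_append[OF assms(1,2)])
  qed auto
qed


section \<open>The generalized quaternion group\<close>

datatype quat_gen = X | Y

definition quaternion_relations :: "nat \<Rightarrow> (quat_gen letter list \<times> quat_gen letter list) set" where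
  "quaternion_relations n =
    {(replicate (2 * n) (Gen Y), []),
     (replicate 2 (Gen X), replicate n (Gen Y)),
     ([Gen X, Gen Y, GenInv X], [GenInv Y])}"

text \<open>The argument is \<open>n\<close>, not the order \<open>4n\<close>.\<close>

definition generalized_quaternion_group :: "nat \<Rightarrow> quat_gen letter list set monoid" where
  "generalized_quaternion_group n = presented_group (quaternion_relations n)"


section \<open>The non-commuting graph\<close>

definition group_center :: "('a, 'b) monoid_scheme \<Rightarrow> 'a set" where
  "group_center G = {z \<in> carrier G. \<forall>g\<in>carrier G. z \<otimes>\<^bsub>G\<^esub> g = g \<otimes>\<^bsub>G\<^esub> z}"

text \<open>An undirected edge is represented by its two opposite arcs.\<close>

definition non_commuting_graph :: "('a, 'b) monoid_scheme \<Rightarrow> 'a pair_pre_digraph" where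
  "non_commuting_graph G =
    \<lparr> pverts = carrier G - group_center G,
      parcs = {(x, y). x \<in> carrier G - group_center G \<and> y \<in> carrier G - group_center G
                 \<and> x \<otimes>\<^bsub>G\<^esub> y \<noteq> y \<otimes>\<^bsub>G\<^esub> x} \<rparr>"

lemma pair_graph_non_commuting_graph:
  assumes "finite (carrier G)"
  shows "pair_graph (non_commuting_graph G)"
proof unfold_locales
  show "finite (parcs (non_commuting_graph G))"
    by (rule finite_subset[of _ "carrier G \<times> carrier G"])
      (auto simp: non_commuting_graph_def assms)
qed (auto simp: non_commuting_graph_def assms symmetric_def sym_def)


section \<open>Laplacian matrix and Laplacian spectrum\<close>

text \<open>Matrices are indexed by positions in an enumeration \<open>vs\<close> of the vertices. Entries are taken
  in the complex numbers, so that the characteristic polynomial has all its roots there. For a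
  symmetric arc relation the out-degree is the degree.\<close>

definition degree_matrix :: "'a pair_pre_digraph \<Rightarrow> 'a list \<Rightarrow> complex mat" where
  "degree_matrix \<Gamma> vs = mat (length vs) (length vs)
    (\<lambda>(i, j). if i = j then of_nat (out_degree (with_proj \<Gamma>) (vs ! i)) else 0)"

definition adjacency_matrix :: "'a pair_pre_digraph \<Rightarrow> 'a list \<Rightarrow> complex mat" where
  "adjacency_matrix \<Gamma> vs = mat (length vs) (length vs)
    (\<lambda>(i, j). if (vs ! i, vs ! j) \<in> parcs \<Gamma> then 1 else 0)"

definition laplacian_matrix :: "'a pair_pre_digraph \<Rightarrow> 'a list \<Rightarrow> complex mat" where
  "laplacian_matrix \<Gamma> vs = degree_matrix \<Gamma> vs - adjacency_matrix \<Gamma> vs"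

definition mat_spectrum :: "complex mat \<Rightarrow> complex multiset" where
  "mat_spectrum A = proots (char_poly A)"

text \<open>Meaningful for finite graphs only; the chosen enumeration does not matter, see
  \<open>laplacian_spectrum_eq\<close> below.\<close>

definition laplacian_spectrum :: "'a pair_pre_digraph \<Rightarrow> complex multiset" where
  "laplacian_spectrum \<Gamma> =
    mat_spectrum (laplacian_matrix \<Gamma> (SOME vs. distinct vs \<and> set vs = pverts \<Gamma>))"

lemma char_poly_reindex:
  fixes f :: "'a \<Rightarrow> 'a \<Rightarrow> complex"
  assumes vs: "distinct vs" and ws: "distinct ws" and eq: "set vs = set ws"
  shows "char_poly (mat (length vs) (length vs) (\<lambda>(i, j). f (vs ! i) (vs ! j))) =
         char_poly (mat (length ws) (length ws) (\<lambda>(i, j). f (ws ! i) (ws ! j)))"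
proof (rule char_poly_similar)
  let ?n = "length vs"
  have n: "length ws = ?n" using assms by (metis distinct_card)
  let ?A = "mat ?n ?n (\<lambda>(i, j). f (vs ! i) (vs ! j))"
  let ?B = "mat ?n ?n (\<lambda>(i, j). f (ws ! i) (ws ! j))"
  have sel: "(\<Sum>k = 0..<length us. if us ! k = a then g (us ! k) else 0) = g a"
    if "distinct us" "a \<in> set us" for us :: "'a list" and a and g :: "'a \<Rightarrow> complex"
  proof -
    have "(\<Sum>k = 0..<length us. if us ! k = a then g (us ! k) else 0)
        = (\<Sum>x\<in>set us. if x = a then g x else 0)"
      by (rule sum.reindex_bij_betw)
        (use that in \<open>auto simp: bij_betw_def inj_on_nth set_conv_nth\<close>)
    then show ?thesis using that(2) by simp
  qed
  define P :: "'a list \<Rightarrow> 'a list \<Rightarrow> complex mat"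
    where "P us us' = mat ?n ?n (\<lambda>(i, j). if us ! i = us' ! j then 1 else 0)" for us us'
  have PP: "P us us' * P us' us = 1\<^sub>m ?n"
    if "distinct us" "distinct us'" "set us = set us'" "length us = ?n" "length us' = ?n" for us us'
  proof (rule eq_matI)
    fix i j assume "i < dim_row (1\<^sub>m ?n :: complex mat)" "j < dim_col (1\<^sub>m ?n :: complex mat)"
    then have ij: "i < ?n" "j < ?n" by auto
    have "(P us us' * P us' us) $$ (i, j) =
        (\<Sum>k = 0..<?n. (if us ! i = us' ! k then 1 else 0) * (if us' ! k = us ! j then 1 else 0))"
      using ij by (simp add: P_def scalar_prod_def)
    also have "\<dots> = (\<Sum>k = 0..<length us'. if us' ! k = us ! i then
                       (\<lambda>x. if x = us ! j then 1 else 0) (us' ! k) else 0)"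
      using that by (intro sum.cong) auto
    also have "\<dots> = (if us ! i = us ! j then 1 else 0)"
    proof (rule sel[where g = "\<lambda>x. if x = us ! j then 1 else 0"])
      show "distinct us'" by fact
      show "us ! i \<in> set us'" using that(3,4) ij(1) by (metis nth_mem)
    qed
    finally show "(P us us' * P us' us) $$ (i, j) = 1\<^sub>m ?n $$ (i, j)"
      using that(1,4) ij by (simp add: nth_eq_iff_index_eq)
  qed (auto simp: P_def)
  have AP: "?A * P vs ws = P vs ws * ?B"
  proof (rule eq_matI)
    fix i j assume "i < dim_row (P vs ws * ?B)" "j < dim_col (P vs ws * ?B)"
    then have ij: "i < ?n" "j < ?n" by (auto simp: P_def)
    have "(?A * P vs ws) $$ (i, j) =
        (\<Sum>k = 0..<length vs. if vs ! k = ws ! j then f (vs ! i) (vs ! k) else 0)"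
      using ij by (auto simp: P_def scalar_prod_def intro!: sum.cong)
    also have "\<dots> = f (vs ! i) (ws ! j)"
      by (rule sel[where g = "f (vs ! i)"]) (use vs ij n in \<open>auto simp: eq\<close>)
    also have "\<dots> = (\<Sum>k = 0..<length ws. if ws ! k = vs ! i then f (ws ! k) (ws ! j) else 0)"
      by (rule sel[where g = "\<lambda>x. f x (ws ! j)", symmetric]) (use ws eq ij in \<open>auto simp flip: eq\<close>)
    also have "\<dots> = (P vs ws * ?B) $$ (i, j)"
      using ij n by (auto simp: P_def scalar_prod_def intro!: sum.cong)
    finally show "(?A * P vs ws) $$ (i, j) = (P vs ws * ?B) $$ (i, j)" .
  qed (auto simp: P_def)
  have car: "P us us' \<in> carrier_mat ?n ?n" for us us' by (simp add: P_def)
  have Ac: "?A \<in> carrier_mat ?n ?n" and Bc: "?B \<in> carrier_mat ?n ?n" by auto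
  have inv: "P vs ws * P ws vs = 1\<^sub>m ?n" "P ws vs * P vs ws = 1\<^sub>m ?n"
    using PP[of vs ws] PP[of ws vs] vs ws eq n by auto
  have "?A = ?A * (P vs ws * P ws vs)" unfolding inv(1) by simp
  also have "\<dots> = ?A * P vs ws * P ws vs"
    by (rule assoc_mult_mat[OF Ac car car, symmetric])
  finally have "?A = P vs ws * ?B * P ws vs" unfolding AP .
  then have "similar_mat ?A ?B"
    using inv car Ac Bc by (intro similar_matI[of _ _ "P vs ws" "P ws vs" ?n]) auto
  then show "similar_mat ?A (mat (length ws) (length ws) (\<lambda>(i, j). f (ws ! i) (ws ! j)))"
    unfolding n .
qed

lemma laplacian_spectrum_eq:
  assumes "distinct vs" "set vs = pverts \<Gamma>"
  shows "laplacian_spectrum \<Gamma> = mat_spectrum (laplacian_matrix \<Gamma> vs)"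
proof -
  define ws where "ws = (SOME vs. distinct vs \<and> set vs = pverts \<Gamma>)"
  have ws: "distinct ws \<and> set ws = pverts \<Gamma>"
    unfolding ws_def by (rule someI[of _ vs]) (use assms in auto)
  define f :: "'a \<Rightarrow> 'a \<Rightarrow> complex" where
    "f x y = (if x = y then of_nat (out_degree (with_proj \<Gamma>) x) else 0)
       - (if (x, y) \<in> parcs \<Gamma> then 1 else 0)" for x y
  have "laplacian_matrix \<Gamma> us = mat (length us) (length us) (\<lambda>(i, j). f (us ! i) (us ! j))"
    if "distinct us" for us
    using that by (intro eq_matI)
      (auto simp: laplacian_matrix_def degree_matrix_def adjacency_matrix_def f_def
        nth_eq_iff_index_eq)
  then show ?thesis
    using char_poly_reindex[of ws vs f] ws assms
    by (simp add: laplacian_spectrum_def mat_spectrum_def flip: ws_def)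
qed

end

(* The elements y^i x^a with 0 <= i < 2n and a in {0,1} exhaust Q_4n, and the explicit group on such
pairs shows that they are distinct. For n >= 2 the centre is {1, y^n}, and commuting is an equivalence
relation on the non-central elements, so the non-commuting graph is complete multipartite: one part
consists of the 2n - 2 non-central powers of y, the n others are the pairs {y^i x, y^(i+n) x}.
A complete multipartite graph on N vertices has Laplacian eigenvalue 0 once, N with multiplicity one
less than the number of parts, and N - m with multiplicity m - 1 for each part of size m. *)

theory Submission
  imports Defs
begin

section \<open>The Laplacian spectrum of a complete multipartite graph\<close>

text \<open>A nonzero determinant makes \<open>P\<close> invertible, so \<open>A * P = P * B\<close>
  gives \<open>A = P * B * Q\<close> with \<open>Q\<close> the inverse. A change of basis can thus
  be checked without computing that inverse.\<close>

lemma similar_mat_of_intertwining: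
  fixes A B P :: "'a :: field mat"
  assumes A: "A \<in> carrier_mat n n" and B: "B \<in> carrier_mat n n" and P: "P \<in> carrier_mat n n"
    and "det P \<noteq> 0" and "A * P = P * B"
  shows "similar_mat A B"
proof -
  obtain Q where Q: "Q \<in> carrier_mat n n" "Q * P = 1\<^sub>m n" "P * Q = 1\<^sub>m n"
    using det_non_zero_imp_unit[OF P \<open>det P \<noteq> 0\<close>, of undefined]
    by (auto simp: Units_def ring_mat_def)
  have "A = A * (P * Q)" using A Q by simp
  also have "\<dots> = P * B * Q" using assoc_mult_mat[OF A P Q(1)] assms(5) by simp
  finally show ?thesis using A B P Q by (intro similar_matI[of _ _ P Q n]) auto
qed

text \<open>Positions \<open>0, \<dots>, k - 1\<close> carry representatives of the \<open>k\<close> parts. With respect to the basis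
  consisting of the all-ones vector, the indicator vectors of the parts \<open>1, \<dots>, k - 1\<close> and the
  unit vectors at the remaining positions, the Laplacian is upper triangular.\<close>

lemma char_poly_complete_multipartite:
  fixes c :: "nat \<Rightarrow> nat" and N k :: nat
  defines "m \<equiv> \<lambda>p. of_nat (card {i. i < N \<and> c i = p}) :: 'a :: field"
  assumes k: "0 < k" "k \<le> N" and rep: "\<And>i. i < k \<Longrightarrow> c i = i" and part: "\<And>i. i < N \<Longrightarrow> c i < k"
  shows "char_poly (mat N N (\<lambda>(i, j). if i = j then of_nat N - m (c i) else if c i = c j then 0 else - 1))
    = [:0, 1:] * [:- of_nat N, 1:] ^ (k - 1) * (\<Prod>i\<in>{k..<N}. [:- (of_nat N - m (c i)), 1:])"
    (is "char_poly ?L = _")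
proof -
  \<comment> \<open>Truth values as field elements: matrix products become sums of indicators, to be
    evaluated by \<open>sume\<close> and \<open>summ\<close>.\<close>
  define e :: "bool \<Rightarrow> 'a" where "e b = (if b then 1 else 0)" for b
  have e [simp]: "e True = 1" "e False = 0" by (simp_all add: e_def)
  \<comment> \<open>The columns of \<open>P\<close> are the basis vectors; the all-ones vector takes
    the place of the indicator of part 0. The \<open>d j\<close> will be the eigenvalues.\<close>
  define P where "P i j = (if j = 0 then 1 else if j < k then e (c i = j) else e (i = j))" for i j
  define d where "d j = (if j = 0 then 0 else if j < k then of_nat N else of_nat N - m (c j))" for j
  \<comment> \<open>Column \<open>j\<close> holds the coordinates of the image of basis vector
    \<open>j\<close>. The indicator of part \<open>j\<close> goes to \<open>N\<close> times itself
    minus \<open>m j\<close> times the all-ones vector. The unit vector at \<open>j\<close> goes to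
    \<open>N - m (c j)\<close> times itself plus the indicator of its part minus the all-ones
    vector; for part 0 the last two terms combine to minus the sum of the other indicators.\<close>
  define T where "T i j = (if i = j then d j else 0) +
      (if j = 0 then 0 else if j < k then - m j * e (i = 0)
       else if c j = 0 then - e (0 < i \<and> i < k) else e (i = c j) - e (i = 0))" for i j
  have sume: "(\<Sum>l<N. e (l = j) * f l) = f j" if "j < N" for f :: "nat \<Rightarrow> 'a" and j
  proof -
    have "(\<Sum>l<N. e (l = j) * f l) = (\<Sum>l<N. if l = j then f l else 0)"
      by (intro sum.cong) (auto simp: e_def)
    then show ?thesis using that by simp
  qed
  have summ: "(\<Sum>l<N. e (c l = p)) = m p" for p
    by (auto simp: m_def e_def sum.If_cases simp flip: sum.inter_filter
        intro!: arg_cong[of _ _ card] arg_cong[of _ _ of_nat])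
  define L where "L i l = e (l = i) * (of_nat N - m (c i)) + e (c l = c i) - 1" for i l
  have L: "?L = mat N N (\<lambda>(i, j). L i j)"
    by (rule eq_matI) (auto simp: L_def e_def)
  have LP: "(\<Sum>l<N. L i l * P l j) = (\<Sum>l<N. P i l * T l j)" if i: "i < N" and j: "j < N" for i j
  proof -
    consider "j = 0" | "0 < j" "j < k" | "k \<le> j" "c j = 0" | "k \<le> j" "c j \<noteq> 0" by linarith
    then show ?thesis
    proof cases
      case 1
      then have "T l j = 0" for l by (simp add: T_def d_def)
      moreover have "(\<Sum>l<N. L i l * P l j) = 0"
        using i 1 by (simp add: P_def L_def sum.distrib sum_subtractf sume summ)
      ultimately show ?thesis by simp
    next
      case 2
      have "L i l * P l j = e (l = i) * ((of_nat N - m (c i)) * e (c l = j))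
          + e (c i = j) * e (c l = j) - e (c l = j)" for l
        using 2 by (auto simp: L_def P_def e_def)
      then have 1: "(\<Sum>l<N. L i l * P l j)
          = (of_nat N - m (c i)) * e (c i = j) + e (c i = j) * m j - m j"
        using sume[OF i, of "\<lambda>l. (of_nat N - m (c i)) * e (c l = j)"]
        by (simp add: sum.distrib sum_subtractf summ flip: sum_distrib_left)
      have "P i l * T l j = e (l = j) * (P i l * of_nat N) - e (l = 0) * (P i l * m j)" for l
        using 2 by (auto simp: T_def e_def d_def)
      then have "(\<Sum>l<N. P i l * T l j) = P i j * of_nat N - P i 0 * m j"
        using j k by (simp add: sum_subtractf sume)
      with 1 2 show ?thesis by (auto simp: P_def e_def)
    next
      case 3
      then have "P l j = e (l = j)" for l
        using k by (simp add: P_def)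
      then have 1: "(\<Sum>l<N. L i l * P l j) = L i j"
        using sume[OF j, of "L i"] by (simp add: mult.commute)
      have "P i l * T l j = e (l = j) * (P i l * d j) - (if 0 < l \<and> l < k then e (l = c i) else 0)" for l
        using 3 k by (auto simp: T_def P_def e_def)
      then have "(\<Sum>l<N. P i l * T l j)
          = P i j * d j - (\<Sum>l<N. e (l = c i) * (if 0 < l \<and> l < k then 1 else 0))"
        using sume[OF j, of "\<lambda>l. P i l * d j"]
        by (simp add: sum_subtractf) (auto intro!: sum.cong simp: e_def)
      also have "c i < N" using part[OF i] k by simp
      \<comment> \<open>The indicators of the parts \<open>1, ..., k - 1\<close> add up to 1 at
        \<open>i\<close> unless \<open>i\<close> lies in part 0.\<close>
      then have "(\<Sum>l<N. e (l = c i) * (if 0 < l \<and> l < k then 1 else 0 :: 'a)) = e (c i \<noteq> 0)"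
        using part[OF i] by (subst sume) (auto simp: e_def)
      finally show ?thesis using 1 3 k by (auto simp: P_def d_def L_def e_def)
    next
      case 4
      then have "P l j = e (l = j)" for l
        using k by (simp add: P_def)
      then have 1: "(\<Sum>l<N. L i l * P l j) = L i j"
        using sume[OF j, of "L i"] by (simp add: mult.commute)
      have cj: "c j < k" "c j < N" using part[OF j] k by auto
      have "P i l * T l j = e (l = j) * (P i l * d j) + e (l = c j) * P i l - e (l = 0) * P i l" for l
        using 4 k cj by (auto simp: T_def P_def e_def)
      then have "(\<Sum>l<N. P i l * T l j) = P i j * d j + P i (c j) - P i 0"
        using sume[OF j, of "\<lambda>l. P i l * d j"] sume[of 0 "P i"] sume[of "c j" "P i"] j k cj
        by (simp add: sum_subtractf sum.distrib)
      with 1 4 k cj show ?thesis by (auto simp: P_def d_def L_def e_def)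
    qed
  qed
  let ?P = "mat N N (\<lambda>(i, j). P i j)" and ?T = "mat N N (\<lambda>(i, j). T i j)"
  have "?L * ?P = ?P * ?T"
    unfolding L by (rule eq_matI) (use LP in \<open>auto simp: scalar_prod_def atLeast0LessThan\<close>)
  moreover have "det ?P \<noteq> 0"
  proof -
    \<comment> \<open>Since \<open>c i = i\<close> for representatives, row \<open>i\<close>
      vanishes to the right of the diagonal, and the diagonal consists of ones.\<close>
    have "det ?P = prod_list (diag_mat ?P)"
      by (rule det_lower_triangular[of N]) (auto simp: P_def e_def rep)
    also have "\<dots> = (\<Prod>i<N. P i i)"
      by (simp add: prod_list_diag_prod atLeast0LessThan)
    also have "\<dots> = 1"
      by (rule prod.neutral) (auto simp: P_def e_def rep)
    finally show ?thesis by simp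
  qed
  ultimately have "similar_mat ?L ?T"
    by (intro similar_mat_of_intertwining[of _ N _ ?P]) auto
  then have "char_poly ?L = char_poly ?T" by (rule char_poly_similar)
  also have "\<dots> = (\<Prod>a\<leftarrow>diag_mat ?T. [:- a, 1:])"
  proof (rule char_poly_upper_triangular[of _ N])
    show "upper_triangular ?T"
    proof (rule upper_triangularI)
      fix i j assume "j < i" "i < dim_row ?T"
      \<comment> \<open>For \<open>k \<le> j\<close> the off-diagonal entries of column
        \<open>j\<close> sit in rows below index \<open>k\<close>, hence above the diagonal.\<close>
      moreover from this have "c j < k" using part by simp
      ultimately show "?T $$ (i, j) = 0" by (auto simp: T_def e_def)
    qed
  qed simp
  also have "\<dots> = (\<Prod>i<N. [:- T i i, 1:])"
    by (simp add: diag_mat_def comp_def prod.list_conv_set_nth atLeast0LessThan)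
  also have "\<dots> = (\<Prod>i<N. [:- d i, 1:])"
    using part by (intro prod.cong) (force simp: T_def e_def)+
  also have "{..<N} = {0} \<union> {1..<k} \<union> {k..<N}" using k by auto
  also have "(\<Prod>i\<in>\<dots>. [:- d i, 1:]) =
      [:0, 1:] * (\<Prod>i\<in>{1..<k}. [:- d i, 1:]) * (\<Prod>i\<in>{k..<N}. [:- d i, 1:])"
    using k by (subst prod.union_disjoint, (auto)[3])+ (simp add: d_def)
  also have "(\<Prod>i\<in>{1..<k}. [:- d i, 1:]) = [:- of_nat N, 1:] ^ (k - 1)"
    by (simp add: d_def)
  also have "(\<Prod>i\<in>{k..<N}. [:- d i, 1:]) = (\<Prod>i\<in>{k..<N}. [:- (of_nat N - m (c i)), 1:])"
    using k by (intro prod.cong) (auto simp: d_def)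
  finally show ?thesis .
qed

lemma card_Collect_nth:
  assumes "distinct vs"
  shows "card {i. i < length vs \<and> P (vs ! i)} = card {v \<in> set vs. P v}"
  using assms
  by (intro bij_betw_same_card[of "(!) vs"])
    (auto simp: bij_betw_def inj_on_def nth_eq_iff_index_eq set_conv_nth)

lemma sum_const_mset: "(\<Sum>_\<in>A. {#x#}) = replicate_mset (card A) x"
  by (induction A rule: infinite_finite_induct) auto

text \<open>The parts are the fibres of \<open>c\<close>. Listing one representative of each part
  first brings the Laplacian into the form treated above; the remaining \<open>m p - 1\<close>
  vertices of part \<open>p\<close> account for the eigenvalue \<open>N - m p\<close>, where
  \<open>N\<close> is the number of vertices.\<close>

lemma laplacian_spectrum_complete_multipartite:
  fixes \<Gamma> :: "'a pair_pre_digraph" and c :: "'a \<Rightarrow> 'b"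
  defines "m \<equiv> \<lambda>p. card {v \<in> pverts \<Gamma>. c v = p}"
  assumes fin: "finite (pverts \<Gamma>)" and ne: "pverts \<Gamma> \<noteq> {}"
    and arcs: "parcs \<Gamma> = {(u, v). u \<in> pverts \<Gamma> \<and> v \<in> pverts \<Gamma> \<and> c u \<noteq> c v}"
  shows "laplacian_spectrum \<Gamma> = {#0#}
    + replicate_mset (card (c ` pverts \<Gamma>) - 1) (of_nat (card (pverts \<Gamma>)))
    + (\<Sum>p\<in>c ` pverts \<Gamma>. replicate_mset (m p - 1) (of_nat (card (pverts \<Gamma>)) - of_nat (m p)))"
proof -
  let ?V = "pverts \<Gamma>"
  obtain ps where ps: "distinct ps" "set ps = c ` ?V"
    using finite_distinct_list[of "c ` ?V"] fin by blast
  define r where "r = inv_into ?V c"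
  have r: "r p \<in> ?V" "c (r p) = p" if "p \<in> c ` ?V" for p
    using that by (simp_all add: r_def inv_into_into f_inv_into_f)
  define R where "R = r ` c ` ?V"
  have R: "R \<subseteq> ?V" using r by (auto simp: R_def)
  obtain qs where qs: "distinct qs" "set qs = ?V - R"
    using finite_distinct_list[of "?V - R"] fin by blast
  define vs where "vs = map r ps @ qs"
  have "inj_on r (c ` ?V)" using r by (metis inj_onI)
  then have vs: "distinct vs" "set vs = ?V"
    using ps qs R by (auto simp: vs_def distinct_map R_def)
  define N where "N = length vs"
  define k where "k = length ps"
  have N: "N = card ?V" using vs by (metis N_def distinct_card)
  have k: "k = card (c ` ?V)" using ps by (metis k_def distinct_card)
  have kN: "0 < k" "k \<le> N"
    using ne fin card_image_le[OF fin, of c] by (auto simp: k N card_gt_0_iff)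
  \<comment> \<open>Part labels of arbitrary type are replaced by their positions in
    \<open>ps\<close>, so that representative \<open>i\<close> has label \<open>i\<close>.\<close>
  define cls where "cls = (\<lambda>i. inv_into {..<k} ((!) ps) (c (vs ! i)))"
  have bij: "bij_betw ((!) ps) {..<k} (c ` ?V)"
    using ps by (metis bij_betw_nth k_def)
  have nth_V: "vs ! i \<in> ?V" if "i < N" for i using that vs by (metis N_def nth_mem)
  have cls_less: "cls i < k" if "i < N" for i
  proof -
    have "inv_into {..<k} ((!) ps) (c (vs ! i)) \<in> {..<k}"
      by (rule inv_into_into) (use bij nth_V[OF that] in \<open>simp add: bij_betw_def\<close>)
    then show ?thesis by (simp add: cls_def)
  qed
  have cls_rep: "cls i = i" if "i < k" for i
  proof -
    have "ps ! i \<in> c ` ?V" using that ps by (metis k_def nth_mem)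
    then have "c (vs ! i) = ps ! i"
      using that r(2) by (simp add: vs_def nth_append k_def)
    then show ?thesis using bij that by (simp add: cls_def bij_betw_def)
  qed
  have cls_eq: "cls i = cls j \<longleftrightarrow> c (vs ! i) = c (vs ! j)" if "i < N" "j < N" for i j
  proof -
    have "c (vs ! i) \<in> (!) ps ` {..<k}" "c (vs ! j) \<in> (!) ps ` {..<k}"
      using bij nth_V that by (simp_all add: bij_betw_def)
    then show ?thesis unfolding cls_def by (metis f_inv_into_f)
  qed
  have card_cls: "card {l. l < N \<and> cls l = cls i} = m (c (vs ! i))" if "i < N" for i
  proof -
    have "{l. l < N \<and> cls l = cls i} = {l. l < N \<and> c (vs ! l) = c (vs ! i)}"
      using cls_eq that by auto
    then show ?thesis using card_Collect_nth[OF vs(1), of "\<lambda>v. c v = c (vs ! i)"]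
      by (simp add: N_def m_def vs(2))
  qed
  have m_le: "m p \<le> N" for p
    unfolding m_def N by (rule card_mono) (use fin in auto)
  have deg: "out_degree (with_proj \<Gamma>) v = N - m (c v)" if "v \<in> ?V" for v
  proof -
    \<comment> \<open>A vertex is joined to everything outside its own part, and that part contains
      the vertex itself.\<close>
    have "out_arcs (with_proj \<Gamma>) v = Pair v ` (?V - {u \<in> ?V. c u = c v})"
      using that by (auto simp: out_arcs_def arcs)
    then have "out_degree (with_proj \<Gamma>) v = card (?V - {u \<in> ?V. c u = c v})"
      by (simp add: out_degree_def card_image inj_on_def)
    then show ?thesis using fin by (simp add: m_def N card_Diff_subset)
  qed
  have "laplacian_matrix \<Gamma> vs = mat N N (\<lambda>(i, j).
      if i = j then of_nat N - of_nat (card {l. l < N \<and> cls l = cls i})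
      else if cls i = cls j then 0 else - 1)"
    by (rule eq_matI)
      (auto simp: laplacian_matrix_def degree_matrix_def adjacency_matrix_def N_def[symmetric]
        deg nth_V card_cls cls_eq arcs of_nat_diff m_le)
  then have "char_poly (laplacian_matrix \<Gamma> vs) =
      [:0, 1:] * [:- of_nat N, 1:] ^ (k - 1) *
      (\<Prod>i\<in>{k..<N}. [:- (of_nat N - of_nat (card {l. l < N \<and> cls l = cls i})), 1:])"
    using char_poly_complete_multipartite[OF kN cls_rep cls_less, where 'a = complex] by simp
  also have "(\<Prod>i\<in>{k..<N}. [:- (of_nat N - of_nat (card {l. l < N \<and> cls l = cls i})), 1:])
      = (\<Prod>i\<in>{k..<N}. [:- (of_nat N - of_nat (m (c (vs ! i)))), 1 :: complex:])"
    by (intro prod.cong) (auto simp: card_cls)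
  also have "\<dots> = (\<Prod>v\<in>?V - R. [:- (of_nat N - of_nat (m (c v))), 1 :: complex:])"
  proof (rule prod.reindex_bij_betw)
    have "bij_betw ((!) vs) {k..<N} ((!) vs ` {k..<N})"
      using vs by (auto simp: bij_betw_def inj_on_def nth_eq_iff_index_eq N_def)
    moreover have "(!) vs ` {k..<N} = set qs"
    proof -
      have "{k..<N} = (+) k ` {0..<length qs}" by (simp add: N_def k_def vs_def add.commute)
      then have "(!) vs ` {k..<N} = (!) qs ` {0..<length qs}"
        by (simp only: image_image) (simp add: vs_def nth_append k_def)
      then show ?thesis by (auto simp: set_conv_nth)
    qed
    ultimately show "bij_betw ((!) vs) {k..<N} (?V - R)" by (simp add: qs)
  qed
  finally have "mat_spectrum (laplacian_matrix \<Gamma> vs) = proots ([:0, 1:] * [:- of_nat N, 1:] ^ (k - 1) *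
      (\<Prod>v\<in>?V - R. [:- (of_nat N - of_nat (m (c v))), 1:]))"
    by (simp only: mat_spectrum_def)
  also have "\<dots> = proots [:0, 1:] + proots ([:- of_nat N, 1:] ^ (k - 1)) +
      proots (\<Prod>v\<in>?V - R. [:- (of_nat N - of_nat (m (c v))), 1:])"
    using fin by (subst proots_mult, simp, simp)+ simp
  also have "\<dots> = {#0#} + replicate_mset (k - 1) (of_nat N)
      + (\<Sum>v\<in>?V - R. {#of_nat N - of_nat (m (c v))#})"
    by (simp add: proots_power proots_prod)
  \<comment> \<open>The non-representatives are grouped by part; each part has lost exactly one
    vertex to \<open>R\<close>.\<close>
  also have "(\<Sum>v\<in>?V - R. {#of_nat N - of_nat (m (c v))#} :: complex multiset) =
      (\<Sum>p\<in>c ` ?V. \<Sum>v\<in>{v \<in> ?V - R. c v = p}. {#of_nat N - of_nat (m (c v))#})"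
    by (rule sum.group[symmetric]) (use fin in auto)
  also have "\<dots> = (\<Sum>p\<in>c ` ?V. replicate_mset (m p - 1) (of_nat N - of_nat (m p)))"
  proof (rule sum.cong[OF HOL.refl])
    fix p assume p: "p \<in> c ` ?V"
    have "{v \<in> ?V - R. c v = p} = {v \<in> ?V. c v = p} - {r p}"
      using r p by (auto simp: R_def)
    then have "card {v \<in> ?V - R. c v = p} = m p - 1"
      using r[OF p] fin by (simp add: m_def)
    then show "(\<Sum>v\<in>{v \<in> ?V - R. c v = p}. {#of_nat N - of_nat (m (c v))#} :: complex multiset)
        = replicate_mset (m p - 1) (of_nat N - of_nat (m p))"
      by (simp add: sum_const_mset)
  qed
  finally show ?thesis
    using laplacian_spectrum_eq[OF vs] by (simp add: N k)
qed

section \<open>Isomorphism invariance\<close>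

text \<open>If one graph is enumerated by \<open>vs\<close> and the other by
  \<open>map f vs\<close>, the two Laplacian matrices are equal. The inclusions \<open>sub\<close>
  keep arcs among the vertices, where \<open>f\<close> is known to respect adjacency.\<close>

lemma laplacian_spectrum_iso:
  assumes fin: "finite (pverts \<Gamma>)" and f: "bij_betw f (pverts \<Gamma>) (pverts \<Delta>)"
    and arcs: "\<And>u v. u \<in> pverts \<Gamma> \<Longrightarrow> v \<in> pverts \<Gamma> \<Longrightarrow> (f u, f v) \<in> parcs \<Delta> \<longleftrightarrow> (u, v) \<in> parcs \<Gamma>"
    and sub: "parcs \<Gamma> \<subseteq> pverts \<Gamma> \<times> pverts \<Gamma>" "parcs \<Delta> \<subseteq> pverts \<Delta> \<times> pverts \<Delta>"
  shows "laplacian_spectrum \<Gamma> = laplacian_spectrum \<Delta>"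
proof -
  obtain vs where vs: "distinct vs" "set vs = pverts \<Gamma>"
    using finite_distinct_list[OF fin] by blast
  have ws: "distinct (map f vs)" "set (map f vs) = pverts \<Delta>"
    using vs f by (auto simp: distinct_map bij_betw_def)
  have "out_degree (with_proj \<Delta>) (f v) = out_degree (with_proj \<Gamma>) v" if v: "v \<in> pverts \<Gamma>" for v
  proof -
    have "out_arcs (with_proj \<Delta>) (f v) = map_prod f f ` out_arcs (with_proj \<Gamma>) v"
    proof (intro equalityI subsetI)
      fix e assume e: "e \<in> out_arcs (with_proj \<Delta>) (f v)"
      then obtain w where w: "e = (f v, w)" "w \<in> pverts \<Delta>" "(f v, w) \<in> parcs \<Delta>"
        using sub by (cases e) (auto simp: out_arcs_def)
      then obtain u where "u \<in> pverts \<Gamma>" "w = f u" using f by (auto simp: bij_betw_def)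
      with w v arcs show "e \<in> map_prod f f ` out_arcs (with_proj \<Gamma>) v"
        by (auto simp: out_arcs_def intro!: image_eqI[of _ _ "(v, u)"])
    next
      fix e assume "e \<in> map_prod f f ` out_arcs (with_proj \<Gamma>) v"
      then show "e \<in> out_arcs (with_proj \<Delta>) (f v)"
        using arcs sub(1) by (force simp: out_arcs_def)
    qed
    moreover have "inj_on (map_prod f f) (out_arcs (with_proj \<Gamma>) v)"
      using f sub(1) by (intro inj_on_subset[OF map_prod_inj_on[of f "pverts \<Gamma>" f "pverts \<Gamma>"]])
        (auto simp: bij_betw_def out_arcs_def)
    ultimately show ?thesis by (simp add: out_degree_def card_image)
  qed
  moreover have "vs ! i \<in> pverts \<Gamma>" if "i < length vs" for i
    using that vs by (metis nth_mem)
  ultimately have "laplacian_matrix \<Delta> (map f vs) = laplacian_matrix \<Gamma> vs"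
    using arcs by (intro eq_matI)
      (auto simp: laplacian_matrix_def degree_matrix_def adjacency_matrix_def)
  then show ?thesis
    by (simp add: laplacian_spectrum_eq[OF vs] laplacian_spectrum_eq[OF ws])
qed

text \<open>Injectivity lets \<open>\<phi>\<close> reflect commutation, and surjectivity then
  matches the centres. This permits passing from the presented group to an explicit one.\<close>

lemma laplacian_spectrum_non_commuting_graph_iso:
  assumes G: "group G" "finite (carrier G)" and H: "group H" and \<phi>: "\<phi> \<in> iso G H"
  shows "laplacian_spectrum (non_commuting_graph G) = laplacian_spectrum (non_commuting_graph H)"
proof (rule laplacian_spectrum_iso)
  interpret group_hom G H \<phi>
    using \<phi> by (intro group_hom.intro group_hom_axioms.intro G H) (simp add: iso_def)
  have inj: "inj_on \<phi> (carrier G)" and img: "carrier H = \<phi> ` carrier G"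
    using \<phi> by (auto simp: iso_def bij_betw_def)
  have comm: "\<phi> u \<otimes>\<^bsub>H\<^esub> \<phi> v = \<phi> v \<otimes>\<^bsub>H\<^esub> \<phi> u \<longleftrightarrow> u \<otimes>\<^bsub>G\<^esub> v = v \<otimes>\<^bsub>G\<^esub> u"
    if "u \<in> carrier G" "v \<in> carrier G" for u v
    using that inj_onD[OF inj] by (metis G.m_closed hom_mult)
  have center: "\<phi> u \<in> group_center H \<longleftrightarrow> u \<in> group_center G" if "u \<in> carrier G" for u
    using that by (simp add: group_center_def img comm)
  then have "\<phi> ` (carrier G - group_center G) = carrier H - group_center H"
    by (auto simp: img)
  then show "bij_betw \<phi> (pverts (non_commuting_graph G)) (pverts (non_commuting_graph H))"
    using inj_on_subset[OF inj] by (auto simp: bij_betw_def non_commuting_graph_def)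
  show "(\<phi> u, \<phi> v) \<in> parcs (non_commuting_graph H) \<longleftrightarrow> (u, v) \<in> parcs (non_commuting_graph G)"
    if "u \<in> pverts (non_commuting_graph G)" "v \<in> pverts (non_commuting_graph G)" for u v
    using that by (auto simp: non_commuting_graph_def comm center)
qed (use G in \<open>auto simp: non_commuting_graph_def\<close>)

section \<open>Normal forms in the generalized quaternion group\<close>

text \<open>By induction on words, \<open>\<psi>\<close> sends the value of a word to its class,
  which gives surjectivity. If two values have the same image, their words are congruent, and
  congruent words have equal values because \<open>H\<close> satisfies the relations; this gives
  injectivity.\<close>

lemma presented_group_isoI:
  assumes H: "group H" and f: "range f \<subseteq> carrier H"
    and R: "\<And>u v. (u, v) \<in> R \<Longrightarrow> word_eval H f u = word_eval H f v"
    and gen: "\<And>h. h \<in> carrier H \<Longrightarrow> \<exists>w. h = word_eval H f w"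
    and \<psi>: "\<psi> \<in> hom H (presented_group R)" "\<And>a. \<psi> (f a) = pres_rel R `` {[Gen a]}"
  shows "\<psi> \<in> iso H (presented_group R)"
proof -
  let ?G = "presented_group R"
  interpret H: group H by fact
  interpret G: group ?G by (rule group_presented_group)
  interpret group_hom H ?G \<psi> by unfold_locales (rule \<psi>)
  have car: "carrier ?G = range (\<lambda>w. pres_rel R `` {w})"
    by (auto simp: presented_group_def quotient_def)
  have one: "\<one>\<^bsub>?G\<^esub> = pres_rel R `` {[]}"
    by (simp add: presented_group_def)
  have f': "f a \<in> carrier H" for a using f by auto
  have inv: "inv\<^bsub>?G\<^esub> (pres_rel R `` {[Gen a]}) = pres_rel R `` {[GenInv a]}" for a
  proof (rule G.inv_equality)
    show "pres_rel R `` {[GenInv a]} \<otimes>\<^bsub>?G\<^esub> pres_rel R `` {[Gen a]} = \<one>\<^bsub>?G\<^esub>"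
      unfolding presented_group_mult_class one
      by (rule equiv_class_eq[OF equiv_pres_rel]) (simp add: pres_rel_def pres_eq.cancel2)
  qed (auto simp: car)
  have letter: "\<psi> (letter_eval H f l) = pres_rel R `` {[l]}" for l
    by (cases l) (simp_all add: \<psi> f' inv)
  have letter_closed: "letter_eval H f l \<in> carrier H" for l
    by (cases l) (simp_all add: f')
  have eval: "\<psi> (word_eval H f w) = pres_rel R `` {w}" for w
  proof (induction w)
    case Nil
    then show ?case using hom_one by (simp add: word_eval_def one)
  next
    case (Cons l w)
    have "word_eval H f (l # w) = letter_eval H f l \<otimes>\<^bsub>H\<^esub> word_eval H f w"
      by (simp add: word_eval_def)
    then show ?case
      using Cons letter letter_closed word_eval_closed[OF H f]
      by (simp add: presented_group_mult_class)
  qed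
  have "inj_on \<psi> (carrier H)"
  proof (rule inj_onI)
    fix g h assume gh: "g \<in> carrier H" "h \<in> carrier H" "\<psi> g = \<psi> h"
    obtain u v where uv: "g = word_eval H f u" "h = word_eval H f v" using gh gen by metis
    then have "pres_rel R `` {u} = pres_rel R `` {v}" using gh eval by simp
    then have "pres_eq R u v"
      using eq_equiv_class[OF _ equiv_pres_rel] by (fastforce simp: pres_rel_def)
    then show "g = h" using word_eval_pres_eq[OF H f R] uv by blast
  qed
  moreover have "\<psi> ` carrier H = carrier ?G"
  proof
    show "carrier ?G \<subseteq> \<psi> ` carrier H"
      unfolding car by (rule image_subsetI) (simp add: word_eval_closed[OF H f] flip: eval)
  qed auto
  ultimately show ?thesis using \<psi> by (simp add: iso_def bij_betw_def)
qed

section \<open>An explicit model of the generalized quaternion group\<close>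

text \<open>The pair \<open>(i, a)\<close> stands for \<open>y\<^sup>i x\<^sup>a\<close>.\<close>

definition quaternion_model :: "nat \<Rightarrow> (int \<times> bool) monoid" where
  "quaternion_model n =
    \<lparr> carrier = {0..<2 * int n} \<times> UNIV,
      mult = (\<lambda>(i, a) (j, b).
        ((i + (if a then - j else j) + (if a \<and> b then int n else 0)) mod (2 * int n), a \<noteq> b)),
      one = (0, False) \<rparr>"

lemma carrier_quaternion_model [simp]: "carrier (quaternion_model n) = {0..<2 * int n} \<times> UNIV"
  and one_quaternion_model [simp]: "\<one>\<^bsub>quaternion_model n\<^esub> = (0, False)"
  and mult_quaternion_model [simp]: "(i, a) \<otimes>\<^bsub>quaternion_model n\<^esub> (j, b) =
    ((i + (if a then - j else j) + (if a \<and> b then int n else 0)) mod (2 * int n), a \<noteq> b)"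
  by (simp_all add: quaternion_model_def)

text \<open>Associativity is checked on unreduced exponents: both bracketings agree modulo
  \<open>2 n\<close>, since a sign change of the summand \<open>n\<close> does not matter
  there.\<close>

lemma group_quaternion_model:
  assumes "n > 0"
  shows "group (quaternion_model n)"
proof (rule groupI)
  fix g h k
  assume "g \<in> carrier (quaternion_model n)" "h \<in> carrier (quaternion_model n)"
    "k \<in> carrier (quaternion_model n)"
  obtain i a j b l d where ghk: "g = (i, a)" "h = (j, b)" "k = (l, d)" by (metis surj_pair)
  let ?M = "2 * int n"
  \<comment> \<open>\<open>s\<close> and \<open>t\<close> are the unreduced exponents of
    \<open>g h\<close> and \<open>h k\<close>; \<open>v\<close> is what \<open>k\<close> adds to
    \<open>(g h) k\<close>, and \<open>w\<close> is the \<open>n\<close> coming from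
    \<open>x\<^sup>2\<close> in \<open>g (h k)\<close>.\<close>
  define s where "s = i + (if a then - j else j) + (if a \<and> b then int n else 0)"
  define t where "t = j + (if b then - l else l) + (if b \<and> d then int n else 0)"
  define v where "v = (if a \<noteq> b then - l else l) + (if (a \<noteq> b) \<and> d then int n else 0)"
  define w where "w = (if a \<and> (b \<noteq> d) then int n else 0)"
  have "(s mod ?M + v) mod ?M = (s + v) mod ?M"
    by (rule mod_add_left_eq)
  also have "\<dots> = (i + (if a then - t else t) + w) mod ?M"
    by (simp add: s_def t_def v_def w_def mod_eq_dvd_iff)
  also have "\<dots> = (i + (if a then - (t mod ?M) else t mod ?M) + w) mod ?M"
    using mod_diff_right_eq[of "i + w" t ?M] mod_add_right_eq[of "i + w" t ?M]
    by (simp add: algebra_simps)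
  finally show "g \<otimes>\<^bsub>quaternion_model n\<^esub> h \<otimes>\<^bsub>quaternion_model n\<^esub> k =
      g \<otimes>\<^bsub>quaternion_model n\<^esub> (h \<otimes>\<^bsub>quaternion_model n\<^esub> k)"
    by (auto simp: ghk s_def t_def v_def w_def add.assoc)
next
  fix g assume g: "g \<in> carrier (quaternion_model n)"
  obtain i a where ia: "g = (i, a)" by (cases g)
  show "\<exists>h\<in>carrier (quaternion_model n). h \<otimes>\<^bsub>quaternion_model n\<^esub> g = \<one>\<^bsub>quaternion_model n\<^esub>"
    using assms
    \<comment> \<open>The inverse of \<open>y\<^sup>i x\<close> is
      \<open>y\<^sup>i\<^sup>+\<^sup>n x\<close>, with the exponent brought into range.\<close>
    by (intro bexI[of _ "if a then (if i < int n then i + int n else i - int n, True) else ((- i) mod (2 * int n), False)"])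
      (use g in \<open>auto simp: ia mod_simps\<close>)
qed (use assms in auto)

definition quaternion_gens :: "quat_gen \<Rightarrow> int \<times> bool" where
  "quaternion_gens g = (case g of X \<Rightarrow> (0, True) | Y \<Rightarrow> (1, False))"

lemma quaternion_gens_simps [simp]: "quaternion_gens X = (0, True)" "quaternion_gens Y = (1, False)"
  by (simp_all add: quaternion_gens_def)

lemma range_quaternion_gens:
  "n > 0 \<Longrightarrow> range quaternion_gens \<subseteq> carrier (quaternion_model n)"
  by (auto simp: quaternion_gens_def split: quat_gen.splits)

lemma word_eval_quaternion_model_power:
  "word_eval (quaternion_model n) quaternion_gens (replicate i (Gen Y)) = (int i mod (2 * int n), False)"
  by (induction i) (simp_all add: word_eval_def mod_simps)

lemma word_eval_quaternion_model_generates: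
  assumes n: "n > 0" and h: "h \<in> carrier (quaternion_model n)"
  shows "\<exists>w. h = word_eval (quaternion_model n) quaternion_gens w"
proof -
  obtain i a where ia: "h = (i, a)" by (cases h)
  have "word_eval (quaternion_model n) quaternion_gens
      (replicate (nat i) (Gen Y) @ (if a then [Gen X] else [])) = h"
    using h by (simp add: ia word_eval_append[OF group_quaternion_model[OF n] range_quaternion_gens[OF n]]
        word_eval_quaternion_model_power) (simp add: word_eval_def)
  then show ?thesis by metis
qed

lemma quaternion_model_relations:
  assumes n: "n > 0" and "(u, v) \<in> quaternion_relations n"
  shows "word_eval (quaternion_model n) quaternion_gens u = word_eval (quaternion_model n) quaternion_gens v"
proof -
  interpret group "quaternion_model n" by (rule group_quaternion_model[OF n])
  have "inv\<^bsub>quaternion_model n\<^esub> (1, False) = ((- 1) mod (2 * int n), False)"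
    using n by (intro inv_equality) (auto simp: mod_simps)
  moreover have "inv\<^bsub>quaternion_model n\<^esub> (0, True) = (int n, True)"
    using n by (intro inv_equality) auto
  ultimately show ?thesis
    using assms by (auto simp: quaternion_relations_def word_eval_quaternion_model_power)
      (auto simp: word_eval_def numeral_2_eq_2 mod_simps)
qed

section \<open>The homomorphism from the model to the presented group\<close>

text \<open>Conjugation by \<open>x\<close> is an endomorphism, and endomorphisms commute with
  integer powers.\<close>

lemma (in group) int_pow_conj:
  assumes "x \<in> carrier G" "y \<in> carrier G"
  shows "x \<otimes> y [^] (i :: int) \<otimes> inv x = (x \<otimes> y \<otimes> inv x) [^] i"
proof -
  have "(\<lambda>z. x \<otimes> z \<otimes> inv x) \<in> hom G G"
  proof (rule homI)
    fix u v assume uv: "u \<in> carrier G" "v \<in> carrier G"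
    have "inv x \<otimes> (x \<otimes> z) = z" if "z \<in> carrier G" for z
      using assms that by (simp flip: m_assoc)
    then show "x \<otimes> (u \<otimes> v) \<otimes> inv x = x \<otimes> u \<otimes> inv x \<otimes> (x \<otimes> v \<otimes> inv x)"
      using assms uv by (simp add: m_assoc)
  qed (use assms in simp)
  then interpret group_hom G G "\<lambda>z. x \<otimes> z \<otimes> inv x"
    by unfold_locales
  show ?thesis using assms by (simp add: hom_int_pow)
qed

text \<open>The relations alone force the multiplication rule of the model: \<open>swap\<close>
  moves \<open>x\<close> past powers of \<open>y\<close>, \<open>xx\<close> removes a second
  \<open>x\<close>, and \<open>red\<close> reduces exponents modulo \<open>2 n\<close>.\<close>

lemma (in group) quaternion_normal_form_hom:
  assumes x: "x \<in> carrier G" and y: "y \<in> carrier G"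
    and y2n: "y [^] (2 * n) = \<one>" and xx: "x \<otimes> x = y [^] n" and xy: "x \<otimes> y \<otimes> inv x = inv y"
  shows "(\<lambda>(i, a). y [^] i \<otimes> (if a then x else \<one>)) \<in> hom (quaternion_model n) G"
proof -
  have red: "y [^] (i mod (2 * int n)) = y [^] i" for i :: int
  proof -
    have "y [^] (2 * int n) = \<one>" using y2n by (metis int_pow_int of_nat_mult of_nat_numeral)
    then have "y [^] (2 * int n * (i div (2 * int n))) = \<one>"
      using y by (simp add: int_pow_pow[symmetric])
    moreover have "y [^] i = y [^] (2 * int n * (i div (2 * int n)) + i mod (2 * int n))"
      by simp
    ultimately show ?thesis using y by (simp only: int_pow_mult) simp
  qed
  have swap: "x \<otimes> y [^] i = y [^] (- i) \<otimes> x" for i :: int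
  proof -
    have "x \<otimes> y [^] i \<otimes> inv x = y [^] (- i)"
      using x y by (simp add: int_pow_conj xy int_pow_inv int_pow_neg)
    then show ?thesis using x y by (metis inv_solve_right int_pow_closed m_closed)
  qed
  \<comment> \<open>The factor \<open>z\<close> stands for \<open>\<one>\<close> or
    \<open>x\<close>, covering both forms of the right factor.\<close>
  have "y [^] i \<otimes> x \<otimes> (y [^] j \<otimes> z) = y [^] (i - j) \<otimes> (x \<otimes> z)" if "z \<in> carrier G" for i j :: int and z
  proof -
    have "y [^] i \<otimes> x \<otimes> (y [^] j \<otimes> z) = y [^] i \<otimes> (x \<otimes> y [^] j) \<otimes> z"
      using x y that by (simp add: m_assoc)
    also have "\<dots> = y [^] i \<otimes> y [^] (- j) \<otimes> (x \<otimes> z)"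
      unfolding swap using x y that by (simp add: m_assoc)
    finally show ?thesis using y by (simp add: int_pow_mult[symmetric])
  qed
  note reflect = this
  show ?thesis
  proof (rule homI)
    fix g assume "g \<in> carrier (quaternion_model n)"
    then show "(\<lambda>(i, a). y [^] i \<otimes> (if a then x else \<one>)) g \<in> carrier G"
      using x y by (cases g) simp
  next
    fix g h :: "int \<times> bool"
    obtain i a j b where gh: "g = (i, a)" "h = (j, b)" by (metis surj_pair)
    have xx': "x \<otimes> x = y [^] int n" using xx by (simp add: int_pow_int)
    show "(\<lambda>(i, a). y [^] i \<otimes> (if a then x else \<one>)) (g \<otimes>\<^bsub>quaternion_model n\<^esub> h) =
        (\<lambda>(i, a). y [^] i \<otimes> (if a then x else \<one>)) g \<otimes> (\<lambda>(i, a). y [^] i \<otimes> (if a then x else \<one>)) h"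
      using x y reflect[of \<one> i j] reflect[of x i j]
      by (cases a; cases b) (auto simp: gh red xx' m_assoc int_pow_mult)
  qed
qed

text \<open>The classes of the generators satisfy the relations, so the normal forms give a
  homomorphism from the model. It is bijective because the model satisfies the relations too and is
  generated by its two generators.\<close>

lemma generalized_quaternion_group_iso:
  assumes n: "n > 0"
  shows "quaternion_model n \<cong> generalized_quaternion_group n"
proof -
  let ?R = "quaternion_relations n" and ?G = "generalized_quaternion_group n"
  interpret group ?G
    unfolding generalized_quaternion_group_def by (rule group_presented_group)
  define cls where "cls w = pres_rel ?R `` {w}" for w
  have cls: "cls w \<in> carrier ?G" for w
    by (auto simp: cls_def generalized_quaternion_group_def presented_group_def quotient_def)
  have mult: "cls (u @ v) = cls u \<otimes>\<^bsub>?G\<^esub> cls v" for u v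
    by (simp add: cls_def generalized_quaternion_group_def presented_group_mult_class)
  have one: "\<one>\<^bsub>?G\<^esub> = cls []"
    by (simp add: cls_def generalized_quaternion_group_def presented_group_def)
  have eqI: "cls u = cls v" if "pres_eq ?R u v" for u v
    unfolding cls_def by (rule equiv_class_eq[OF equiv_pres_rel]) (simp add: pres_rel_def that)
  have pow: "cls (replicate k (Gen Y)) = cls [Gen Y] [^]\<^bsub>?G\<^esub> k" for k :: nat
  proof (induction k)
    case (Suc k)
    have "replicate (Suc k) (Gen Y) = replicate k (Gen Y) @ [Gen Y]"
      by (simp add: replicate_append_same)
    then show ?case using Suc by (simp add: mult)
  qed (simp add: one)
  have inv: "cls [GenInv g] = inv\<^bsub>?G\<^esub> cls [Gen g]" for g
    using eqI[OF pres_eq.cancel2[of ?R g]] mult[of "[GenInv g]" "[Gen g]"]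
    by (intro inv_equality[symmetric] cls) (simp add: one)
  have "cls [Gen Y] [^]\<^bsub>?G\<^esub> (2 * n) = \<one>\<^bsub>?G\<^esub>"
    unfolding pow[symmetric] one by (rule eqI[OF pres_eq.rel]) (simp add: quaternion_relations_def)
  moreover have "cls [Gen X] \<otimes>\<^bsub>?G\<^esub> cls [Gen X] = cls [Gen Y] [^]\<^bsub>?G\<^esub> n"
    unfolding pow[symmetric] mult[symmetric]
    by (rule eqI[OF pres_eq.rel]) (simp add: quaternion_relations_def numeral_2_eq_2)
  moreover have "cls [Gen X] \<otimes>\<^bsub>?G\<^esub> cls [Gen Y] \<otimes>\<^bsub>?G\<^esub> inv\<^bsub>?G\<^esub> cls [Gen X] = inv\<^bsub>?G\<^esub> cls [Gen Y]"
    unfolding inv[symmetric] mult[symmetric]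
    by (rule eqI[OF pres_eq.rel]) (simp add: quaternion_relations_def)
  ultimately have "(\<lambda>(i, a). cls [Gen Y] [^]\<^bsub>?G\<^esub> i \<otimes>\<^bsub>?G\<^esub> (if a then cls [Gen X] else \<one>\<^bsub>?G\<^esub>))
      \<in> hom (quaternion_model n) ?G" (is "?\<psi> \<in> _")
    by (intro quaternion_normal_form_hom cls)
  then have "?\<psi> \<in> iso (quaternion_model n) (presented_group ?R)"
  proof (intro presented_group_isoI)
    show "?\<psi> (quaternion_gens g) = pres_rel ?R `` {[Gen g]}" for g
      using cls by (cases g) (auto simp: int_pow_1 simp flip: cls_def)
  qed (use n in \<open>auto simp: generalized_quaternion_group_def group_quaternion_model
      quaternion_model_relations word_eval_quaternion_model_generates
      simp del: carrier_quaternion_model dest: range_quaternion_gens\<close>)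
  then show ?thesis
    by (auto simp: is_iso_def generalized_quaternion_group_def)
qed

section \<open>Commutation in the model\<close>

text \<open>The exponents of the two products differ by \<open>2 (i - j)\<close>,
  \<open>- 2 j\<close>, \<open>2 i\<close> or 0, and halving turns divisibility by
  \<open>2 n\<close> into divisibility by \<open>n\<close>.\<close>

lemma quaternion_model_commute_iff:
  "(i, a) \<otimes>\<^bsub>quaternion_model n\<^esub> (j, b) = (j, b) \<otimes>\<^bsub>quaternion_model n\<^esub> (i, a) \<longleftrightarrow>
    (if a then if b then i mod int n = j mod int n else int n dvd j else b \<longrightarrow> int n dvd i)"
proof -
  have 2: "2 * int n dvd k \<longleftrightarrow> int n dvd l" if "k = 2 * l" for k l
    using that by simp
  have "2 * int n dvd (i + - j + int n) - (j + - i + int n) \<longleftrightarrow> int n dvd i - j"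
    by (rule 2) simp
  moreover have "2 * int n dvd (i + - j + 0) - (j + i + 0) \<longleftrightarrow> int n dvd - j"
    by (rule 2) simp
  moreover have "2 * int n dvd (i + j + 0) - (j + - i + 0) \<longleftrightarrow> int n dvd i"
    by (rule 2) simp
  moreover have "i + j + 0 = j + i + 0" by simp
  ultimately show ?thesis
    by (cases a; cases b) (simp_all only: mult_quaternion_model mod_eq_dvd_iff prod.inject
      if_True if_False simp_thms dvd_minus_iff)
qed

section \<open>The non-commuting graph of the generalized quaternion group\<close>

lemma mod_less_twice:
  fixes i n :: int
  assumes "0 \<le> i" "i < 2 * n"
  shows "i mod n = (if i < n then i else i - n)"
  using assms mod_pos_pos_trivial[of "i - n" n] by (simp add: mod_pos_pos_trivial)

lemma dvd_less_twice_iff: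
  fixes i n :: int
  assumes "0 \<le> i" "i < 2 * n"
  shows "n dvd i \<longleftrightarrow> i = 0 \<or> i = n"
  using assms by (auto simp: dvd_eq_mod_eq_0 mod_less_twice)

text \<open>No \<open>y\<^sup>i x\<close> commutes with \<open>y\<close>, as
  \<open>n \<ge> 2\<close> does not divide 1. A power \<open>y\<^sup>i\<close> commutes with the
  elements outside the powers of \<open>y\<close> exactly if \<open>n\<close> divides
  \<open>i\<close>.\<close>

lemma pverts_quaternion_model:
  assumes "n \<ge> 2"
  shows "pverts (non_commuting_graph (quaternion_model n)) =
    ({0..<2 * int n} - {0, int n}) \<times> {False} \<union> {0..<2 * int n} \<times> {True}"
proof -
  have "\<not> int n dvd 1" using assms by simp
  then have "\<not> (\<forall>g\<in>carrier (quaternion_model n). (i, True) \<otimes>\<^bsub>quaternion_model n\<^esub> g =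
      g \<otimes>\<^bsub>quaternion_model n\<^esub> (i, True))" for i
    using assms quaternion_model_commute_iff[of n i True 1 False]
    by (auto simp del: mult_quaternion_model intro!: bexI[of _ "(1, False)"])
  moreover have "(\<forall>g\<in>carrier (quaternion_model n). (i, False) \<otimes>\<^bsub>quaternion_model n\<^esub> g =
      g \<otimes>\<^bsub>quaternion_model n\<^esub> (i, False)) \<longleftrightarrow> i \<in> {0, int n}" if "i \<in> {0..<2 * int n}" for i
    using that assms dvd_less_twice_iff[of i "int n"]
    by (auto simp: quaternion_model_commute_iff simp del: mult_quaternion_model)
  ultimately have "(i, a) \<in> group_center (quaternion_model n) \<longleftrightarrow> i \<in> {0, int n} \<and> \<not> a"
    if "i \<in> {0..<2 * int n}" for i a
    using that by (cases a) (simp_all add: group_center_def)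
  then show ?thesis by (auto simp: non_commuting_graph_def)
qed

lemma laplacian_spectrum_quaternion_model:
  assumes n: "n \<ge> 2"
  shows "laplacian_spectrum (non_commuting_graph (quaternion_model n)) =
           {#0#}
         + replicate_mset (2 * n - 3) (of_nat (2 * n))
         + replicate_mset n (of_nat (4 * n - 4))
         + replicate_mset n (of_nat (4 * n - 2))"
proof -
  let ?\<Gamma> = "non_commuting_graph (quaternion_model n)"
  \<comment> \<open>\<open>None\<close> labels the non-central powers of \<open>y\<close>, and
    \<open>Some r\<close> the pair \<open>y\<^sup>r x\<close>,
    \<open>y\<^sup>r\<^sup>+\<^sup>n x\<close>.\<close>
  define c where "c = (\<lambda>(i, a). if a then Some (i mod int n) else None)"
  note V = pverts_quaternion_model[OF n]
  have card_rot: "card (({0..<2 * int n} - {0, int n}) \<times> {False}) = 2 * n - 2"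
    using n by (simp add: card_cartesian_product card_Diff_subset)
  have card_V: "card (pverts ?\<Gamma>) = 4 * n - 2"
  proof -
    have "card (pverts ?\<Gamma>) = card (({0..<2 * int n} - {0, int n}) \<times> {False}) + card ({0..<2 * int n} \<times> {True})"
      unfolding V by (rule card_Un_disjoint) auto
    then show ?thesis using n by (simp add: card_rot card_cartesian_product)
  qed
  have c_V: "c ` pverts ?\<Gamma> = insert None (Some ` {0..<int n})"
  proof (intro equalityI subsetI)
    fix p assume "p \<in> insert None (Some ` {0..<int n})"
    then consider "p = c (1, False)" | i where "i \<in> {0..<int n}" "p = c (i, True)"
      by (auto simp: c_def)
    then show "p \<in> c ` pverts ?\<Gamma>"
      by cases (use n in \<open>auto simp: V intro!: imageI\<close>)
  qed (use n in \<open>auto simp: V c_def\<close>)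
  have m_None: "card {v \<in> pverts ?\<Gamma>. c v = None} = 2 * n - 2"
    unfolding card_rot[symmetric] by (rule arg_cong[of _ _ card]) (auto simp: V c_def)
  have m_Some: "card {v \<in> pverts ?\<Gamma>. c v = Some p} = 2" if p: "p \<in> {0..<int n}" for p
  proof -
    have "{v \<in> pverts ?\<Gamma>. c v = Some p} = {(p, True), (p + int n, True)}"
      using p by (auto simp: V c_def mod_less_twice split: if_splits)
    then show ?thesis using n by simp
  qed
  have "laplacian_spectrum ?\<Gamma> = {#0#}
    + replicate_mset (card (c ` pverts ?\<Gamma>) - 1) (of_nat (card (pverts ?\<Gamma>)))
    + (\<Sum>p\<in>c ` pverts ?\<Gamma>. replicate_mset (card {v \<in> pverts ?\<Gamma>. c v = p} - 1)
        (of_nat (card (pverts ?\<Gamma>)) - of_nat (card {v \<in> pverts ?\<Gamma>. c v = p})))"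
  proof (rule laplacian_spectrum_complete_multipartite)
    show "finite (pverts ?\<Gamma>)" by (simp add: V)
    show "pverts ?\<Gamma> \<noteq> {}" using n by (auto simp: V)
    \<comment> \<open>For non-central \<open>y\<^sup>i\<close> the number \<open>n\<close> does not
      divide \<open>i\<close>, so it commutes with no \<open>y\<^sup>j x\<close>.\<close>
    have "g \<otimes>\<^bsub>quaternion_model n\<^esub> h = h \<otimes>\<^bsub>quaternion_model n\<^esub> g \<longleftrightarrow> c g = c h"
      if "g \<in> pverts ?\<Gamma>" "h \<in> pverts ?\<Gamma>" for g h
      using that dvd_less_twice_iff[of _ "int n"]
      by (cases g; cases h) (auto simp: V c_def quaternion_model_commute_iff simp del: mult_quaternion_model)
    moreover have "parcs ?\<Gamma> = {(u, v). u \<in> pverts ?\<Gamma> \<and> v \<in> pverts ?\<Gamma>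
        \<and> u \<otimes>\<^bsub>quaternion_model n\<^esub> v \<noteq> v \<otimes>\<^bsub>quaternion_model n\<^esub> u}"
      by (simp add: non_commuting_graph_def)
    ultimately show "parcs ?\<Gamma> = {(u, v). u \<in> pverts ?\<Gamma> \<and> v \<in> pverts ?\<Gamma> \<and> c u \<noteq> c v}"
      by (simp only: cong: conj_cong)
  qed
  \<comment> \<open>There are \<open>n + 1\<close> parts on \<open>4 n - 2\<close> vertices. The
    part \<open>None\<close> of size \<open>2 n - 2\<close> gives \<open>2 n\<close> with
    multiplicity \<open>2 n - 3\<close>; each pair gives \<open>4 n - 4\<close> once.\<close>
  also have "\<dots> = {#0#} + replicate_mset n (of_nat (4 * n - 2))
      + (replicate_mset (2 * n - 3) (of_nat (2 * n)) + (\<Sum>p\<in>{0..<int n}. {#of_nat (4 * n - 4)#}))"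
  proof -
    have "(of_nat (4 * n - 2) - of_nat (2 * n - 2) :: complex) = of_nat (2 * n)"
      "(of_nat (4 * n - 2) - 2 :: complex) = of_nat (4 * n - 4)"
      using n by (simp_all add: of_nat_diff)
    then show ?thesis
      unfolding c_V using n
      by (simp add: sum.reindex m_None m_Some card_V card_image)
  qed
  finally show ?thesis
    using n by (simp add: sum_const_mset add_ac)
qed

theorem corollary3p7:
  fixes n :: nat
  assumes "n \<ge> 2"
  shows "laplacian_spectrum (non_commuting_graph (generalized_quaternion_group n)) =
           {#0#}
         + replicate_mset (2 * n - 3) (of_nat (2 * n))
         + replicate_mset n (of_nat (4 * n - 4))
         + replicate_mset n (of_nat (4 * n - 2))"
proof -
  have n: "n > 0" using assms by simp
  obtain \<phi> where "\<phi> \<in> iso (quaternion_model n) (generalized_quaternion_group n)"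
    using generalized_quaternion_group_iso[OF n] by (auto simp: is_iso_def)
  moreover have "group (generalized_quaternion_group n)"
    by (simp add: generalized_quaternion_group_def group_presented_group)
  \<comment> \<open>The model is the source of the isomorphism because its carrier is visibly
    finite.\<close>
  ultimately have "laplacian_spectrum (non_commuting_graph (quaternion_model n)) =
      laplacian_spectrum (non_commuting_graph (generalized_quaternion_group n))"
    using n by (intro laplacian_spectrum_non_commuting_graph_iso group_quaternion_model) simp_all
  then show ?thesis
    using laplacian_spectrum_quaternion_model[OF assms] by (simp only:)
qed

end
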